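(* Let $\ell\geq 5$ be an integer. Then $\gamma(C_\ell^{-})=0$, where $C_\ell^{-}$ is the tight cycle on $\ell$ vertices with one edge removed. Equivalently: for every $\alpha>0$ there is $n_0$ such that every $3$-uniform hypergraph $H$ on $n\geq n_0$ vertices with $\delta_2(H)\geq \alpha n$ contains a copy of $C_\ell^{-}$.
   Context: A $3$-uniform hypergraph $H$ consists of a vertex set $V(H)$ and an edge set $E(H)$ of $3$-element subsets of $V(H)$. For distinct vertices $u,v$, the codegree $d(uv)$ is the number of edges containing both $u$ and $v$, and $\delta_2(H)=\min_{\{u,v\}} d(uv)$ is the minimum codegree. For a $3$-uniform hypergraph $F$, $\mathrm{ex}_2(n,F)$ is the maximum $d$ such that there is an $F$-free $3$-uniform hypergraph $H$ on $n$ vertices with $\delta_2(H)\geq d$, and the codegree Turán density is $\gamma(F)=\lim_{n\to\infty}\mathrm{ex}_2(n,F)/n$ (this limit exists). For an integer $\ell\geq 3$, the tight cycle $C_\ell$ is the $3$-uniform hypergraph with vertex set $\{v_1,\dots,v_\ell\}$ and edge set $\{v_iv_{i+1}v_{i+2}: i\in\mathbb{Z}/\ell\mathbb{Z}\}$; $C_\ell^{-}$ is $C_\ell$ with one edge removed. *)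

theory Defs
  imports Complex_Main
begin

record 'a hypergraph =
  verts :: "'a set"
  edges :: "'a set set"

definition hypergraph3 :: "'a hypergraph \<Rightarrow> bool" where
  "hypergraph3 H \<longleftrightarrow>
     finite (verts H) \<and> (\<forall>e \<in> edges H. e \<subseteq> verts H \<and> card e = 3)"

definition codegree :: "'a hypergraph \<Rightarrow> 'a \<Rightarrow> 'a \<Rightarrow> nat" where
  "codegree H u v = card {e \<in> edges H. u \<in> e \<and> v \<in> e}"

text \<open>Only meaningful for at least two vertices; otherwise this is the unspecified number
  \<open>Min {}\<close>, which does not affect any asymptotic statement.\<close>

definition min_codegree :: "'a hypergraph \<Rightarrow> nat" where
  "min_codegree H = Min {codegree H u v | u v. u \<in> verts H \<and> v \<in> verts H \<and> u \<noteq> v}"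

text \<open>Copies are not required to be induced.\<close>

definition contains_copy :: "'a hypergraph \<Rightarrow> 'b hypergraph \<Rightarrow> bool" where
  "contains_copy H F \<longleftrightarrow>
     (\<exists>f. inj_on f (verts F) \<and> f ` verts F \<subseteq> verts H \<and> (\<forall>e \<in> edges F. f ` e \<in> edges H))"

text \<open>Every finite hypergraph is isomorphic to one whose vertices are natural numbers, so
  ranging over hypergraphs of that type loses nothing. If \<open>F\<close> has an edge and all its edges are
  nonempty, the set below is nonempty (take \<open>H\<close> edgeless) and finite, so \<open>Max\<close> is a genuine
  maximum.\<close>

definition ex2 :: "nat \<Rightarrow> 'b hypergraph \<Rightarrow> nat" where
  "ex2 n F = Max {d. \<exists>H :: nat hypergraph. hypergraph3 H \<and> card (verts H) = n \<and>
                      \<not> contains_copy H F \<and> min_codegree H \<ge> d}"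

definition codegree_turan_density :: "'b hypergraph \<Rightarrow> real" where
  "codegree_turan_density F = lim (\<lambda>n. real (ex2 n F) / real n)"

definition tight_cycle :: "nat \<Rightarrow> nat hypergraph" where
  "tight_cycle l =
     \<lparr> verts = {0..<l}, edges = {{i, (i + 1) mod l, (i + 2) mod l} | i. i < l} \<rparr>"

text \<open>By rotational symmetry, it does not matter up to isomorphism which edge is removed.\<close>

definition tight_cycle_minus :: "nat \<Rightarrow> nat hypergraph" where
  "tight_cycle_minus l =
     \<lparr> verts = verts (tight_cycle l), edges = edges (tight_cycle l) - {{0, 1, 2}} \<rparr>"

end

theory Submission
  imports Defs "HOL-Library.Ramsey"
begin

text \<open>
  Every \<open>C\<^sub>l\<^sup>-\<close> with \<open>l \<ge> 5\<close> maps homomorphically to \<open>C\<^sub>5\<^sup>-\<close>, so it is contained in the blow-up of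
  \<open>C\<^sub>5\<^sup>-\<close> with parts of size \<open>l\<close>. Such a blow-up with parts \<open>A, Q, E, D, F\<close> and edges
  \<open>AQE, QED, EDF, DFA\<close> amounts to disjoint sets \<open>D, A, E\<close> for which the pairs in
  \<open>(D \<union> A) \<times> E\<close>, and likewise those in \<open>D \<times> (A \<union> E)\<close>, have many common neighbours.
  By averaging, any large enough linearly ordered set of vertices contains large \<open>P < R\<close> for which
  the pairs in \<open>P \<times> R\<close> have linearly many common neighbours. Ramsey's theorem then makes this
  true for all \<open>P < R\<close> of prescribed sizes inside a suitable subset, and one takes \<open>D < A < E\<close> there.
\<close>

section \<open>Lower and upper parts of ordered sets, and Ramsey's theorem\<close>

lemma finite_subset_lower:
  fixes S :: "'a::linorder set"
  assumes "finite S" "k \<le> card S"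
  shows "\<exists>P\<subseteq>S. card P = k \<and> (\<forall>x\<in>P. \<forall>y\<in>S - P. x < y)"
  using assms
proof (induction k)
  case 0
  then show ?case by (intro exI[of _ "{}"]) auto
next
  case (Suc k)
  then obtain P where P: "P \<subseteq> S" "card P = k" "\<forall>x\<in>P. \<forall>y\<in>S - P. x < y" by auto
  have fin: "finite P" "finite (S - P)" using P(1) Suc.prems finite_subset by auto
  have "S - P \<noteq> {}" using P(1,2) Suc.prems(2) by auto
  define m where "m = Min (S - P)"
  have m: "m \<in> S - P" and le: "\<And>y. y \<in> S - P \<Longrightarrow> m \<le> y"
    using fin \<open>S - P \<noteq> {}\<close> unfolding m_def by (auto intro: Min_in Min_le simp del: Diff_iff)
  show ?case
  proof (intro exI[of _ "insert m P"] conjI ballI)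
    show "card (insert m P) = Suc k" using m fin P by simp
    show "x < y" if "x \<in> insert m P" "y \<in> S - insert m P" for x y
      using that P(3) le[of y] by (cases "x = m") (auto simp: less_le)
  qed (use m P in auto)
qed

text \<open>If \<open>P\<close> and \<open>P'\<close> differ, then, having the same size, neither
  contains the other, and points \<open>x\<close> of \<open>P - P'\<close> and \<open>y\<close> of
  \<open>P' - P\<close> lie in \<open>R'\<close> and \<open>R\<close>; this gives both
  \<open>x < y\<close> and \<open>y < x\<close>. Hence a property of a split can be encoded as a
  colour of the unsplit set.\<close>

lemma lower_set_unique:
  fixes P P' :: "'a::linorder set"
  assumes "P \<union> R = P' \<union> R'" "card P = card P'" "finite P" "finite P'"
    and "\<forall>x\<in>P. \<forall>y\<in>R. x < y" "\<forall>x\<in>P'. \<forall>y\<in>R'. x < y"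
  shows "P = P'" "R = R'"
proof -
  show "P = P'"
  proof (rule ccontr)
    assume "P \<noteq> P'"
    then have "\<not> P \<subseteq> P'" "\<not> P' \<subseteq> P"
      using card_subset_eq assms(2-4) by metis+
    then obtain x y where "x \<in> P" "x \<notin> P'" "y \<in> P'" "y \<notin> P" by auto
    then have "x \<in> R'" "y \<in> R" using assms(1) by auto
    then show False using assms(5,6) \<open>x \<in> P\<close> \<open>y \<in> P'\<close> by (meson less_asym)
  qed
  moreover have "P \<inter> R = {}" "P' \<inter> R' = {}" using assms(5,6) by auto
  ultimately show "R = R'" using assms(1) by blast
qed

text \<open>A set of \<open>3 t\<close> numbers is coloured according to whether its splits into a lower and an
  upper part of sizes \<open>2 t, t\<close> and \<open>t, 2 t\<close> are good; the hypothesis excludes large sets on which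
  either kind of split is always bad.\<close>

lemma ramsey_two_splits:
  fixes t m :: nat
  shows "\<exists>N. \<forall>good :: nat set \<Rightarrow> nat set \<Rightarrow> bool.
    (\<forall>Y p r. Y \<subseteq> {..<N} \<longrightarrow> card Y = m \<longrightarrow> p = 2 * t \<and> r = t \<or> p = t \<and> r = 2 * t \<longrightarrow>
       (\<exists>P R. P \<subseteq> Y \<and> R \<subseteq> Y \<and> card P = p \<and> card R = r \<and> (\<forall>x\<in>P. \<forall>y\<in>R. x < y) \<and> good P R)) \<longrightarrow>
    (\<exists>D A E. D \<union> A \<union> E \<subseteq> {..<N} \<and> D \<inter> A = {} \<and> D \<inter> E = {} \<and> A \<inter> E = {} \<and>
       card D = t \<and> card A = t \<and> card E = t \<and> good (D \<union> A) E \<and> good D (A \<union> E))"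
proof -
  \<comment> \<open>A set homogeneous in colour 0 (both splits good) need only have
    \<open>3 * t\<close> elements, since it is itself a coloured set; in colours 1 and 2 it needs
    \<open>m\<close> elements for the hypothesis to apply to it.\<close>
  obtain N :: nat where N: "partn_lst {..<N} [3 * t, m, m] (3 * t)"
    using ramsey_full by blast
  show ?thesis
  proof (rule exI[of _ N], intro allI impI)
    fix good :: "nat set \<Rightarrow> nat set \<Rightarrow> bool"
    assume hyp: "\<forall>Y p r. Y \<subseteq> {..<N} \<longrightarrow> card Y = m \<longrightarrow> p = 2 * t \<and> r = t \<or> p = t \<and> r = 2 * t \<longrightarrow>
       (\<exists>P R. P \<subseteq> Y \<and> R \<subseteq> Y \<and> card P = p \<and> card R = r \<and> (\<forall>x\<in>P. \<forall>y\<in>R. x < y) \<and> good P R)"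
    \<comment> \<open>A finite set has at most one split with given part sizes, so this universal
      form follows from a single good split, as \<open>some_goods\<close> shows.\<close>
    define goods where "goods p r S \<longleftrightarrow> (\<forall>P R. S = P \<union> R \<longrightarrow> card P = p \<longrightarrow> card R = r \<longrightarrow>
      (\<forall>x\<in>P. \<forall>y\<in>R. x < y) \<longrightarrow> good P R)" for p r S
    define f where "f S = (if \<not> goods (2 * t) t S then 1 else if \<not> goods t (2 * t) S then 2
      else 0 :: nat)" for S
    have "f \<in> nsets {..<N} (3 * t) \<rightarrow> {..<length [3 * t, m, m]}"
      by (auto simp: f_def)
    then obtain i where i: "i < length [3 * t, m, m]"
        "monochromatic {..<N} ([3 * t, m, m] ! i) (3 * t) f i"
      using N unfolding partn_lst_def by blast
    then obtain Y where Y: "Y \<in> nsets {..<N} ([3 * t, m, m] ! i)"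
        "f ` nsets Y (3 * t) \<subseteq> {i}"
      unfolding monochromatic_def by blast
    have YN: "Y \<subseteq> {..<N}" and finY: "finite Y" and cardY: "card Y = [3 * t, m, m] ! i"
      using Y(1) by (auto simp: nsets_def)
    have mono: "f S = i" if "S \<subseteq> Y" "card S = 3 * t" for S
      using Y(2) that finite_subset[OF that(1) finY] by (auto simp: nsets_def)
    have some_goods: "\<exists>S\<subseteq>Y. card S = 3 * t \<and> goods p r S"
      if "card Y = m" and pr: "p = 2 * t \<and> r = t \<or> p = t \<and> r = 2 * t" for p r
    proof -
      obtain P R where PR: "P \<subseteq> Y" "R \<subseteq> Y" "card P = p" "card R = r"
          "\<forall>x\<in>P. \<forall>y\<in>R. x < y" "good P R"
        using hyp[rule_format, OF YN \<open>card Y = m\<close> pr] by (elim exE conjE) (rule that)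
      have fin: "finite P" "finite R" using PR(1,2) finY finite_subset by auto
      have "P \<inter> R = {}" using PR(5) by (meson disjoint_iff less_irrefl)
      then have "card (P \<union> R) = 3 * t"
        using PR(3,4) fin pr by (auto simp add: card_Un_disjoint)
      moreover have "goods p r (P \<union> R)"
        unfolding goods_def
      proof (intro allI impI)
        fix P' R'
        assume *: "P \<union> R = P' \<union> R'" "card P' = p" "card R' = r" "\<forall>x\<in>P'. \<forall>y\<in>R'. x < y"
        have "finite P'" using fin * by (metis finite_Un)
        then have "P = P'" "R = R'" using lower_set_unique[OF *(1)] * PR(3,5) fin by auto
        then show "good P' R'" using PR(6) by simp
      qed
      ultimately show ?thesis using PR(1,2) by blast
    qed
    \<comment> \<open>Otherwise \<open>Y\<close> has \<open>m\<close> elements and contains a set of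
      colour other than 1 and a set of colour other than 2, although all its subsets of size
      \<open>3 * t\<close> have colour \<open>i\<close>.\<close>
    have "i = 0"
    proof (rule ccontr)
      assume "i \<noteq> 0"
      then have i12: "i = 1 \<or> i = 2" using i(1) by auto
      then have "card Y = m" using cardY by auto
      from some_goods[OF this, of "2 * t" t] some_goods[OF this, of t "2 * t"]
      obtain S S' where "S \<subseteq> Y" "card S = 3 * t" "goods (2 * t) t S"
          "S' \<subseteq> Y" "card S' = 3 * t" "goods t (2 * t) S'" by auto
      then show False using mono[of S] mono[of S'] i12 by (auto simp: f_def split: if_splits)
    qed
    then have cardY: "card Y = 3 * t" using cardY by simp
    then have good12: "goods (2 * t) t Y" "goods t (2 * t) Y"
      using mono[of Y] \<open>i = 0\<close> by (auto simp: f_def split: if_splits)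
    \<comment> \<open>\<open>D\<close>, \<open>A\<close>, \<open>E\<close> are the lowest, middle
      and highest \<open>t\<close> elements of \<open>Y\<close>, so that \<open>Y\<close> itself
      carries both splits: \<open>D \<union> A\<close> below \<open>E\<close>, and \<open>D\<close>
      below \<open>A \<union> E\<close>.\<close>
    obtain D where D: "D \<subseteq> Y" "card D = t" "\<forall>x\<in>D. \<forall>y\<in>Y - D. x < y"
      using finite_subset_lower[OF finY, of t] cardY by auto
    have finD: "finite D" using D finY finite_subset by auto
    have cYD: "card (Y - D) = 2 * t"
      using D cardY finD by (simp add: card_Diff_subset)
    then obtain A where A: "A \<subseteq> Y - D" "card A = t" "\<forall>x\<in>A. \<forall>y\<in>(Y - D) - A. x < y"
      using finite_subset_lower[of "Y - D" t] finY by auto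
    define E where "E = Y - D - A"
    have finA: "finite A" using finite_subset[OF A(1)] finY by simp
    have cE: "card E = t" unfolding E_def using A cYD finA by (simp add: card_Diff_subset)
    have eq: "Y = D \<union> A \<union> E" "Y = D \<union> (A \<union> E)" "A \<union> E = Y - D" using A D by (auto simp: E_def)
    have cDA: "card (D \<union> A) = 2 * t"
      using A D finA finD by (subst card_Un_disjoint) auto
    have good_DA_E: "good (D \<union> A) E"
    proof (rule good12(1)[unfolded goods_def, rule_format, OF eq(1) cDA cE])
      fix x y assume "x \<in> D \<union> A" "y \<in> E"
      then show "x < y" using A(3) D(3) by (auto simp: E_def)
    qed
    have good_D_AE: "good D (A \<union> E)"
    proof (rule good12(2)[unfolded goods_def, rule_format, OF eq(2) D(2)])
      show "card (A \<union> E) = 2 * t" using cYD eq(3) by simp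
      fix x y assume "x \<in> D" "y \<in> A \<union> E"
      then show "x < y" using D(3) eq(3) by auto
    qed
    show "\<exists>D A E. D \<union> A \<union> E \<subseteq> {..<N} \<and> D \<inter> A = {} \<and> D \<inter> E = {} \<and> A \<inter> E = {} \<and>
       card D = t \<and> card A = t \<and> card E = t \<and> good (D \<union> A) E \<and> good D (A \<union> E)"
    proof (rule exI[of _ D], rule exI[of _ A], rule exI[of _ E], intro conjI)
      show "D \<union> A \<union> E \<subseteq> {..<N}" using YN unfolding eq(1)[symmetric] .
    qed (use A(1,2) D(2) cE good_DA_E good_D_AE in \<open>auto simp: E_def\<close>)
  qed
qed

section \<open>Averaging: common points of many dense sets\<close>

text \<open>Average the number of sets \<open>B i\<close> through a point, then pigeonhole over the subsets of \<open>I\<close>.\<close>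

lemma many_points_in_common:
  fixes \<alpha> :: real and B :: "'i \<Rightarrow> 'a set"
  assumes V: "finite V" "V \<noteq> {}" and I: "finite I" and "s > 0"
    and B: "\<And>i. i \<in> I \<Longrightarrow> B i \<subseteq> V \<and> \<alpha> * card V \<le> card (B i)"
    and s: "2 * real s \<le> \<alpha> * card I"
  shows "\<exists>J\<subseteq>I. card J = s \<and> \<alpha> / 2 / 2 ^ card I * card V \<le> card {v\<in>V. \<forall>i\<in>J. v \<in> B i}"
proof -
  define n where "n = real (card V)"
  define m where "m = real (card I)"
  define d where "d v = card {i\<in>I. v \<in> B i}" for v
  define W where "W = {v\<in>V. s \<le> d v}"
  define F where "F = {J. J \<subseteq> I \<and> card J = s}"
  define common where "common J = {v\<in>V. \<forall>i\<in>J. v \<in> B i}" for J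
  have n: "n > 0" using V by (simp add: n_def card_gt_0_iff)
  have m: "m > 0" using s \<open>s > 0\<close> by (cases "card I = 0") (auto simp: m_def)
  have "\<alpha> > 0" using s \<open>s > 0\<close> m unfolding m_def[symmetric]
    by (smt (verit) of_nat_0_less_iff mult_nonpos_nonneg)
  \<comment> \<open>Count the pairs of an index \<open>i\<close> and a point of \<open>B i\<close>:
    there are at least \<open>\<alpha> * n * m\<close>. A point outside \<open>W\<close> lies in
    fewer than \<open>s\<close> of the sets, a point of \<open>W\<close> in at most
    \<open>m\<close>, so the count is at most \<open>n * s + card W * m\<close>, and
    \<open>n * s\<close> is at most half the lower bound.\<close>
  have "\<alpha> * n * m = (\<Sum>i\<in>I. \<alpha> * n)" by (simp add: m_def)
  also have "\<dots> \<le> (\<Sum>i\<in>I. real (card (B i)))"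
    using B by (intro sum_mono) (simp add: n_def)
  also have "\<dots> = (\<Sum>i\<in>I. \<Sum>v\<in>V. if v \<in> B i then 1 else 0)"
  proof (rule sum.cong)
    fix i assume "i \<in> I"
    then have "B i = {v\<in>V. v \<in> B i}" using B by auto
    then show "real (card (B i)) = (\<Sum>v\<in>V. if v \<in> B i then 1 else 0)"
      using V by (simp add: sum.If_cases Int_def)
  qed simp
  also have "\<dots> = (\<Sum>v\<in>V. real (d v))"
    unfolding d_def using I by (subst sum.swap) (simp add: sum.If_cases Int_def)
  also have "\<dots> \<le> (\<Sum>v\<in>V. real s + (if v \<in> W then m else 0))"
  proof (rule sum_mono)
    fix v assume "v \<in> V"
    then show "real (d v) \<le> real s + (if v \<in> W then m else 0)"
      using card_mono[OF I, of "{i\<in>I. v \<in> B i}"] by (auto simp: W_def d_def m_def)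
  qed
  also have "\<dots> = n * s + card W * m"
    using V by (simp add: sum.distrib sum.If_cases n_def W_def Int_def)
  also have "n * s \<le> n * (\<alpha> * m / 2)"
    using s n by (intro mult_left_mono) (auto simp: m_def)
  finally have "(\<alpha> / 2 * n) * m \<le> card W * m" by (simp add: field_simps)
  then have W: "\<alpha> / 2 * n \<le> card W" using m by simp
  moreover have "0 < \<alpha> / 2 * n" using \<open>\<alpha> > 0\<close> n by simp
  ultimately have "W \<noteq> {}" by auto
  have F: "finite F" "card F \<le> 2 ^ card I"
    using I card_mono[of "Pow I" F] by (auto simp: F_def card_Pow)
  have cover: "W \<subseteq> (\<Union>J\<in>F. common J)"
  proof
    fix v assume "v \<in> W"
    then have v: "v \<in> V" "s \<le> card {i\<in>I. v \<in> B i}" by (auto simp: W_def d_def)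
    then obtain J where "J \<subseteq> {i\<in>I. v \<in> B i}" "card J = s"
      using obtain_subset_with_card_n by blast
    then show "v \<in> (\<Union>J\<in>F. common J)" using v(1) by (auto simp: F_def common_def)
  qed
  \<comment> \<open>At most \<open>2 ^ card I\<close> sets \<open>common J\<close> cover
    \<open>W\<close>, so one of them has at least the average share.\<close>
  have "\<exists>J\<in>F. \<alpha> / 2 / 2 ^ card I * n \<le> card (common J)"
  proof (rule ccontr)
    assume "\<not> ?thesis"
    then have *: "\<And>J. J \<in> F \<Longrightarrow> real (card (common J)) < \<alpha> / 2 / 2 ^ card I * n" by auto
    have "F \<noteq> {}" using cover \<open>W \<noteq> {}\<close> by auto
    have "card W \<le> card (\<Union>J\<in>F. common J)"
      using cover F(1) V by (intro card_mono) (auto simp: common_def)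
    also have "\<dots> \<le> (\<Sum>J\<in>F. card (common J))" using F(1) by (rule card_UN_le)
    finally have "real (card W) \<le> (\<Sum>J\<in>F. real (card (common J)))"
      by (metis of_nat_le_iff of_nat_sum)
    also have "\<dots> < card F * (\<alpha> / 2 / 2 ^ card I * n)"
      using * F(1) \<open>F \<noteq> {}\<close> by (intro sum_bounded_above_strict) (auto simp: card_gt_0_iff)
    also have "\<dots> \<le> 2 ^ card I * (\<alpha> / 2 / 2 ^ card I * n)"
      using F(2) \<open>\<alpha> > 0\<close> n by (intro mult_right_mono) (use of_nat_mono[OF F(2), where 'a=real] in auto)
    also have "\<dots> = \<alpha> / 2 * n" by simp
    finally show False using W by simp
  qed
  then show ?thesis by (auto simp: F_def common_def n_def)
qed

lemma pigeonhole_fiber: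
  assumes "finite J" "f ` J \<subseteq> C" "finite C" "card C * k \<le> card J" "k > 0" "J \<noteq> {}"
  shows "\<exists>c\<in>C. k \<le> card {j\<in>J. f j = c}"
proof (rule ccontr)
  assume "\<not> ?thesis"
  then have *: "\<And>c. c \<in> C \<Longrightarrow> card {j\<in>J. f j = c} < k" by auto
  have "J = (\<Union>c\<in>C. {j\<in>J. f j = c})" using assms(2) by auto
  then have "card J \<le> (\<Sum>c\<in>C. card {j\<in>J. f j = c})"
    using card_UN_le[OF assms(3), of "\<lambda>c. {j\<in>J. f j = c}"] by simp
  also have "\<dots> < card C * k"
  proof -
    have "C \<noteq> {}" using assms by auto
    then show ?thesis
      using sum_strict_mono[OF assms(3), of "\<lambda>c. card {j\<in>J. f j = c}" "\<lambda>_. k"] * by simp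
  qed
  finally show False using assms(4) by simp
qed

text \<open>Averaging is applied twice. For each \<open>j\<close> it yields an
  \<open>s\<close>-subset \<open>P j\<close> of \<open>I\<close> and a dense set of points common to
  the \<open>B i j\<close> with \<open>i\<close> in \<open>P j\<close>; by pigeonhole
  \<open>P j\<close> is one and the same \<open>Q\<close> for many \<open>j\<close>. A second
  averaging, over these \<open>j\<close>, intersects the dense sets themselves.\<close>

lemma complete_bipartite_common:
  fixes \<alpha> :: real
  assumes "\<alpha> > 0" "s > 0" "r > 0"
  shows "\<exists>m1 m2. \<exists>\<gamma>::real. \<gamma> > 0 \<and> (\<forall>(V :: 'a set) (I :: 'i set) (J :: 'j set) B.
    finite V \<longrightarrow> V \<noteq> {} \<longrightarrow> finite I \<longrightarrow> card I = m1 \<longrightarrow> finite J \<longrightarrow> card J = m2 \<longrightarrow>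
    (\<forall>i\<in>I. \<forall>j\<in>J. B i j \<subseteq> V \<and> \<alpha> * card V \<le> card (B i j)) \<longrightarrow>
    (\<exists>P\<subseteq>I. \<exists>R\<subseteq>J. card P = s \<and> card R = r \<and>
       \<gamma> * card V \<le> card {v\<in>V. \<forall>i\<in>P. \<forall>j\<in>R. v \<in> B i j}))"
proof -
  \<comment> \<open>\<open>m1\<close> and \<open>m3\<close> are just large enough for the first and
    the second averaging, \<open>\<beta>\<close> and \<open>\<gamma>\<close> are the densities that
    these leave, and the factor \<open>2 ^ m1\<close> in \<open>m2\<close> counts the subsets of
    \<open>I\<close>, so that the pigeonhole keeps \<open>m3\<close> indices.\<close>
  define m1 where "m1 = nat \<lceil>2 * real s / \<alpha>\<rceil>"
  define \<beta> where "\<beta> = \<alpha> / 2 / 2 ^ m1"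
  define m3 where "m3 = nat \<lceil>2 * real r / \<beta>\<rceil>"
  define m2 where "m2 = 2 ^ m1 * m3"
  define \<gamma> where "\<gamma> = \<beta> / 2 / 2 ^ m3"
  have "\<beta> > 0" using assms by (simp add: \<beta>_def)
  have "2 * real s / \<alpha> \<le> m1" "2 * real r / \<beta> \<le> m3"
    unfolding m1_def m3_def by linarith+
  then have m1: "2 * real s \<le> \<alpha> * m1" and m3: "2 * real r \<le> \<beta> * m3"
    using \<open>\<alpha> > 0\<close> \<open>\<beta> > 0\<close> by (auto simp: field_simps)
  have "m3 > 0" using m3 assms by (cases "m3 = 0") auto
  show ?thesis
  proof (rule exI[of _ m1], rule exI[of _ m2], rule exI[of _ \<gamma>], intro conjI allI impI)
    show "\<gamma> > 0" using \<open>\<beta> > 0\<close> by (simp add: \<gamma>_def)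
    fix V :: "'a set" and I :: "'i set" and J :: "'j set" and B
    assume V: "finite V" "V \<noteq> {}" and I: "finite I" "card I = m1" and J: "finite J" "card J = m2"
      and B: "\<forall>i\<in>I. \<forall>j\<in>J. B i j \<subseteq> V \<and> \<alpha> * card V \<le> card (B i j)"
    have "\<forall>j\<in>J. \<exists>P. P \<subseteq> I \<and> card P = s \<and> \<beta> * card V \<le> card {v\<in>V. \<forall>i\<in>P. v \<in> B i j}"
    proof
      fix j assume "j \<in> J"
      then show "\<exists>P\<subseteq>I. card P = s \<and> \<beta> * card V \<le> card {v\<in>V. \<forall>i\<in>P. v \<in> B i j}"
        unfolding \<beta>_def I(2)[symmetric]
        using B m1 by (intro many_points_in_common[OF V I(1) assms(2)]) (simp_all add: I(2))
    qed
    from bchoice[OF this] obtain P where P: "\<And>j. j \<in> J \<Longrightarrow> P j \<subseteq> I \<and> card (P j) = s \<and>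
        \<beta> * card V \<le> card {v\<in>V. \<forall>i\<in>P j. v \<in> B i j}" by blast
    have "\<exists>Q\<in>Pow I. m3 \<le> card {j\<in>J. P j = Q}"
    proof (rule pigeonhole_fiber)
      show "P ` J \<subseteq> Pow I" using P by blast
      show "card (Pow I) * m3 \<le> card J" using I J by (simp add: m2_def card_Pow)
      show "J \<noteq> {}" using J \<open>m3 > 0\<close> by (auto simp: m2_def)
    qed (use I J \<open>m3 > 0\<close> in simp_all)
    then obtain Q where Q: "Q \<subseteq> I" "m3 \<le> card {j\<in>J. P j = Q}" by auto
    obtain J' where J': "J' \<subseteq> {j\<in>J. P j = Q}" "card J' = m3"
      by (rule obtain_subset_with_card_n[OF Q(2)])
    define C where "C j = {v\<in>V. \<forall>i\<in>Q. v \<in> B i j}" for j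
    have finJ': "finite J'" by (rule finite_subset[OF J'(1)]) (simp add: J)
    have C: "C j \<subseteq> V \<and> \<beta> * card V \<le> card (C j)" if "j \<in> J'" for j
    proof -
      have "j \<in> J" "P j = Q" using that J'(1) by auto
      then show ?thesis using P[of j] by (auto simp: C_def)
    qed
    have "2 * real r \<le> \<beta> * card J'" using m3 J'(2) by simp
    from many_points_in_common[OF V finJ' assms(3) C this]
    have "\<exists>R\<subseteq>J'. card R = r \<and> \<gamma> * card V \<le> card {v\<in>V. \<forall>j\<in>R. v \<in> C j}"
      unfolding \<gamma>_def J'(2) .
    then obtain R where R: "R \<subseteq> J'" "card R = r" "\<gamma> * card V \<le> card {v\<in>V. \<forall>j\<in>R. v \<in> C j}"
      by (elim exE conjE)
    have "J' \<noteq> {}" using J'(2) \<open>m3 > 0\<close> by auto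
    then obtain j where "j \<in> J'" by auto
    then have cQ: "card Q = s" using P[of j] J'(1) by auto
    have "card {v\<in>V. \<forall>j\<in>R. v \<in> C j} \<le> card {v\<in>V. \<forall>i\<in>Q. \<forall>j\<in>R. v \<in> B i j}"
      using V by (intro card_mono) (auto simp: C_def)
    then have "\<gamma> * card V \<le> card {v\<in>V. \<forall>i\<in>Q. \<forall>j\<in>R. v \<in> B i j}"
      using R(3) by linarith
    moreover have "R \<subseteq> J" using R(1) J'(1) by auto
    ultimately show "\<exists>P\<subseteq>I. \<exists>R\<subseteq>J. card P = s \<and> card R = r \<and>
        \<gamma> * card V \<le> card {v\<in>V. \<forall>i\<in>P. \<forall>j\<in>R. v \<in> B i j}"
      using R(2) Q(1) cQ by (intro exI[of _ Q] exI[of _ R] conjI)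
  qed
qed

text \<open>Taking the \<open>m1\<close> lowest elements of \<open>Y\<close> as \<open>I\<close> and
  \<open>m2\<close> others as \<open>J\<close> makes every element of \<open>I\<close> smaller than
  every element of \<open>J\<close>, so the bipartite version applies although \<open>B i j\<close>
  is controlled only for \<open>i < j\<close>.\<close>

lemma ordered_complete_bipartite_common:
  fixes \<alpha> :: real
  assumes "\<alpha> > 0" "s > 0" "r > 0"
  shows "\<exists>m. \<exists>\<gamma>::real. \<gamma> > 0 \<and> (\<forall>(V :: 'a set) (Y :: nat set) B.
    finite V \<longrightarrow> V \<noteq> {} \<longrightarrow> finite Y \<longrightarrow> card Y \<ge> m \<longrightarrow>
    (\<forall>i\<in>Y. \<forall>j\<in>Y. i < j \<longrightarrow> B i j \<subseteq> V \<and> \<alpha> * card V \<le> card (B i j)) \<longrightarrow>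
    (\<exists>P R. P \<subseteq> Y \<and> R \<subseteq> Y \<and> card P = s \<and> card R = r \<and> (\<forall>x\<in>P. \<forall>y\<in>R. x < y) \<and>
       \<gamma> * card V \<le> card {v\<in>V. \<forall>i\<in>P. \<forall>j\<in>R. v \<in> B i j}))"
proof -
  obtain m1 m2 and \<gamma> :: real where "\<gamma> > 0"
    and bip: "\<forall>(V :: 'a set) (I :: nat set) (J :: nat set) B.
    finite V \<longrightarrow> V \<noteq> {} \<longrightarrow> finite I \<longrightarrow> card I = m1 \<longrightarrow> finite J \<longrightarrow> card J = m2 \<longrightarrow>
    (\<forall>i\<in>I. \<forall>j\<in>J. B i j \<subseteq> V \<and> \<alpha> * card V \<le> card (B i j)) \<longrightarrow>
    (\<exists>P\<subseteq>I. \<exists>R\<subseteq>J. card P = s \<and> card R = r \<and>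
       \<gamma> * card V \<le> card {v\<in>V. \<forall>i\<in>P. \<forall>j\<in>R. v \<in> B i j})"
    using complete_bipartite_common[OF assms] by (elim exE conjE)
  show ?thesis
  proof (rule exI[of _ "m1 + m2"], rule exI[of _ \<gamma>], intro conjI allI impI)
    show "\<gamma> > 0" by fact
    fix V :: "'a set" and Y :: "nat set" and B
    assume V: "finite V" "V \<noteq> {}" and Y: "finite Y" "m1 + m2 \<le> card Y"
      and B: "\<forall>i\<in>Y. \<forall>j\<in>Y. i < j \<longrightarrow> B i j \<subseteq> V \<and> \<alpha> * card V \<le> card (B i j)"
    obtain I where I: "I \<subseteq> Y" "card I = m1" "\<forall>x\<in>I. \<forall>y\<in>Y - I. x < y"
      using finite_subset_lower[OF Y(1), of m1] Y(2) by auto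
    have finI: "finite I" using finite_subset[OF I(1) Y(1)] .
    have "m2 \<le> card (Y - I)" using I Y finI by (simp add: card_Diff_subset)
    then obtain J where J: "J \<subseteq> Y - I" "card J = m2"
      by (rule obtain_subset_with_card_n)
    have finJ: "finite J" using finite_subset[OF J(1)] Y(1) by simp
    have "\<forall>i\<in>I. \<forall>j\<in>J. B i j \<subseteq> V \<and> \<alpha> * card V \<le> card (B i j)"
    proof (intro ballI)
      fix i j assume "i \<in> I" "j \<in> J"
      then show "B i j \<subseteq> V \<and> \<alpha> * card V \<le> card (B i j)"
        using B I(1,3) J(1) by (meson DiffD1 subsetD)
    qed
    from bip[THEN spec, of V, THEN spec, of I, THEN spec, of J, THEN spec, of B, THEN mp, OF V(1),
        THEN mp, OF V(2), THEN mp, OF finI, THEN mp, OF I(2), THEN mp, OF finJ, THEN mp, OF J(2),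
        THEN mp, OF this]
    obtain P R where PR: "P \<subseteq> I" "R \<subseteq> J" "card P = s" "card R = r"
      "\<gamma> * card V \<le> card {v\<in>V. \<forall>i\<in>P. \<forall>j\<in>R. v \<in> B i j}"
      by (elim exE conjE)
    show "\<exists>P R. P \<subseteq> Y \<and> R \<subseteq> Y \<and> card P = s \<and> card R = r \<and> (\<forall>x\<in>P. \<forall>y\<in>R. x < y) \<and>
       \<gamma> * card V \<le> card {v\<in>V. \<forall>i\<in>P. \<forall>j\<in>R. v \<in> B i j}"
    proof (rule exI[of _ P], rule exI[of _ R], intro conjI)
      show "\<forall>x\<in>P. \<forall>y\<in>R. x < y" using I(3) J(1) PR(1,2) by blast
      show "P \<subseteq> Y" "R \<subseteq> Y" using I(1) J(1) PR(1,2) by auto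
    qed (fact PR)+
  qed
qed

section \<open>The blow-up of \<open>C_5^-\<close> under large codegree\<close>

text \<open>Numbering \<open>L\<close> vertices gives them an order, and a split is called good when
  its cross pairs have \<open>2 * t\<close> common neighbours. Ramsey's theorem gives disjoint
  \<open>D\<close>, \<open>A\<close>, \<open>E\<close> with both splits good; \<open>Q\<close> is
  taken from the common neighbours of one split, \<open>F\<close> from those of the other. As
  \<open>N\<close> is only an abstract neighbourhood function, disjointness of \<open>Q\<close> and
  \<open>F\<close> from the other parts is left to be read off the edges later.\<close>

lemma blowup_of_large_codegree:
  fixes \<alpha> :: real
  assumes "\<alpha> > 0" "t > 0"
  shows "\<exists>n0. \<forall>(V :: 'a set) N. finite V \<longrightarrow> n0 \<le> card V \<longrightarrow>
    (\<forall>u\<in>V. \<forall>v\<in>V. u \<noteq> v \<longrightarrow> N u v \<subseteq> V \<and> \<alpha> * card V \<le> card (N u v)) \<longrightarrow>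
    (\<exists>A Q E D F. A \<union> E \<union> D \<subseteq> V \<and> A \<inter> E = {} \<and> A \<inter> D = {} \<and> E \<inter> D = {} \<and> Q \<inter> F = {} \<and>
       card A = t \<and> card Q = t \<and> card E = t \<and> card D = t \<and> card F = t \<and>
       (\<forall>u\<in>D \<union> A. \<forall>v\<in>E. Q \<subseteq> N u v) \<and> (\<forall>u\<in>D. \<forall>v\<in>A \<union> E. F \<subseteq> N u v))"
proof -
  have t2: "2 * t > 0" using assms by simp
  obtain m \<gamma> where \<gamma>: "\<gamma> > 0" and m: "\<forall>(V :: 'a set) (Y :: nat set) B.
    finite V \<longrightarrow> V \<noteq> {} \<longrightarrow> finite Y \<longrightarrow> card Y \<ge> m \<longrightarrow>
    (\<forall>i\<in>Y. \<forall>j\<in>Y. i < j \<longrightarrow> B i j \<subseteq> V \<and> \<alpha> * card V \<le> card (B i j)) \<longrightarrow>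
    (\<exists>P R. P \<subseteq> Y \<and> R \<subseteq> Y \<and> card P = 2 * t \<and> card R = t \<and> (\<forall>x\<in>P. \<forall>y\<in>R. x < y) \<and>
       \<gamma> * real (card V) \<le> card {v\<in>V. \<forall>i\<in>P. \<forall>j\<in>R. v \<in> B i j})"
    using ordered_complete_bipartite_common[OF assms(1) t2 assms(2)] by (elim exE conjE)
  obtain m' \<gamma>' where \<gamma>': "\<gamma>' > 0" and m': "\<forall>(V :: 'a set) (Y :: nat set) B.
    finite V \<longrightarrow> V \<noteq> {} \<longrightarrow> finite Y \<longrightarrow> card Y \<ge> m' \<longrightarrow>
    (\<forall>i\<in>Y. \<forall>j\<in>Y. i < j \<longrightarrow> B i j \<subseteq> V \<and> \<alpha> * card V \<le> card (B i j)) \<longrightarrow>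
    (\<exists>P R. P \<subseteq> Y \<and> R \<subseteq> Y \<and> card P = t \<and> card R = 2 * t \<and> (\<forall>x\<in>P. \<forall>y\<in>R. x < y) \<and>
       \<gamma>' * real (card V) \<le> card {v\<in>V. \<forall>i\<in>P. \<forall>j\<in>R. v \<in> B i j})"
    using ordered_complete_bipartite_common[OF assms(1) assms(2) t2] by (elim exE conjE)
  define M where "M = max m m'"
  obtain L where L: "\<forall>good :: nat set \<Rightarrow> nat set \<Rightarrow> bool.
    (\<forall>Y p r. Y \<subseteq> {..<L} \<longrightarrow> card Y = M \<longrightarrow> p = 2 * t \<and> r = t \<or> p = t \<and> r = 2 * t \<longrightarrow>
       (\<exists>P R. P \<subseteq> Y \<and> R \<subseteq> Y \<and> card P = p \<and> card R = r \<and> (\<forall>x\<in>P. \<forall>y\<in>R. x < y) \<and> good P R)) \<longrightarrow>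
    (\<exists>D A E. D \<union> A \<union> E \<subseteq> {..<L} \<and> D \<inter> A = {} \<and> D \<inter> E = {} \<and> A \<inter> E = {} \<and>
       card D = t \<and> card A = t \<and> card E = t \<and> good (D \<union> A) E \<and> good D (A \<union> E))"
    using ramsey_two_splits[of M t] by (elim exE)
  \<comment> \<open>\<open>L\<close> provides the vertices to number, 1 makes \<open>V\<close>
    nonempty, and the ceilings make \<open>\<gamma> * card V\<close> and
    \<open>\<gamma>' * card V\<close> at least \<open>2 * t\<close>.\<close>
  define n0 where "n0 = L + 1 + nat \<lceil>2 * real t / \<gamma>\<rceil> + nat \<lceil>2 * real t / \<gamma>'\<rceil>"
  show ?thesis
  proof (rule exI[of _ n0], intro allI impI)
    fix V :: "'a set" and N
    assume V: "finite V" "n0 \<le> card V"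
      and N: "\<forall>u\<in>V. \<forall>v\<in>V. u \<noteq> v \<longrightarrow> N u v \<subseteq> V \<and> \<alpha> * card V \<le> card (N u v)"
    have "V \<noteq> {}" using V by (auto simp: n0_def)
    have "L \<le> card V" using V by (simp add: n0_def)
    then obtain g where g: "inj_on g {..<L}" "g ` {..<L} \<subseteq> V"
      using card_le_inj[of "{..<L}" V] V by auto
    have "2 * real t / \<gamma> \<le> n0" "2 * real t / \<gamma>' \<le> n0"
      unfolding n0_def by linarith+
    then have "2 * real t / \<gamma> \<le> card V" "2 * real t / \<gamma>' \<le> card V"
      using V(2) by linarith+
    then have large: "2 * t \<le> \<gamma> * card V" "2 * t \<le> \<gamma>' * card V"
      using \<gamma> \<gamma>' by (auto simp: field_simps)
    define B where "B i j = N (g i) (g j)" for i j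
    define common where "common P R = {v\<in>V. \<forall>i\<in>P. \<forall>j\<in>R. v \<in> B i j}" for P R
    \<comment> \<open>Twice \<open>t\<close>, because \<open>F\<close> is chosen after the
      \<open>t\<close> points of \<open>Q\<close> have been removed.\<close>
    define good where "good P R \<longleftrightarrow> 2 * t \<le> card (common P R)" for P R
    have split: "\<exists>P R. P \<subseteq> Y \<and> R \<subseteq> Y \<and> card P = p \<and> card R = r \<and> (\<forall>x\<in>P. \<forall>y\<in>R. x < y) \<and> good P R"
      if Y: "Y \<subseteq> {..<L}" "card Y = M" and pr: "p = 2 * t \<and> r = t \<or> p = t \<and> r = 2 * t" for Y p r
    proof -
      have finY: "finite Y" using finite_subset[OF Y(1)] by simp
      have mM: "m \<le> card Y" "m' \<le> card Y" using Y(2) by (simp_all add: M_def)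
      have B: "B i j \<subseteq> V \<and> \<alpha> * card V \<le> card (B i j)" if "i \<in> Y" "j \<in> Y" "i < j" for i j
      proof -
        have ij: "i \<in> {..<L}" "j \<in> {..<L}" using that Y(1) by auto
        then have "g i \<noteq> g j" using inj_onD[OF g(1), of i j] that(3) by auto
        moreover have "g i \<in> V" "g j \<in> V" using ij g(2) by auto
        ultimately show ?thesis using N by (simp add: B_def)
      qed
      have B': "\<forall>i\<in>Y. \<forall>j\<in>Y. i < j \<longrightarrow> B i j \<subseteq> V \<and> \<alpha> * card V \<le> card (B i j)"
        using B by blast
      have goodI: "good P R" if "c \<le> card {v\<in>V. \<forall>i\<in>P. \<forall>j\<in>R. v \<in> B i j}" "2 * t \<le> c"
        for P R and c :: real
        using that unfolding good_def common_def by linarith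
      from pr show ?thesis
      proof
        assume "p = 2 * t \<and> r = t"
        then show ?thesis
          using m[THEN spec, of V, THEN spec, of Y, THEN spec, of B, THEN mp, OF V(1), THEN mp,
            OF \<open>V \<noteq> {}\<close>, THEN mp, OF finY, THEN mp, OF mM(1), THEN mp, OF B'] goodI large(1) by blast
      next
        assume "p = t \<and> r = 2 * t"
        then show ?thesis
          using m'[THEN spec, of V, THEN spec, of Y, THEN spec, of B, THEN mp, OF V(1), THEN mp,
            OF \<open>V \<noteq> {}\<close>, THEN mp, OF finY, THEN mp, OF mM(2), THEN mp, OF B'] goodI large(2) by blast
      qed
    qed
    have "\<exists>D A E. D \<union> A \<union> E \<subseteq> {..<L} \<and> D \<inter> A = {} \<and> D \<inter> E = {} \<and> A \<inter> E = {} \<and>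
       card D = t \<and> card A = t \<and> card E = t \<and> good (D \<union> A) E \<and> good D (A \<union> E)"
      using split by (intro L[rule_format])
    then obtain D A E where DAE: "D \<union> A \<union> E \<subseteq> {..<L}" "D \<inter> A = {}" "D \<inter> E = {}" "A \<inter> E = {}"
       "card D = t" "card A = t" "card E = t" and good: "good (D \<union> A) E" "good D (A \<union> E)"
      by (elim exE conjE)
    have sub: "D \<subseteq> {..<L}" "A \<subseteq> {..<L}" "E \<subseteq> {..<L}" using DAE(1) by auto
    obtain Q where Q: "Q \<subseteq> common (D \<union> A) E" "card Q = t" "finite Q"
      using good(1) obtain_subset_with_card_n[of t "common (D \<union> A) E"] by (auto simp: good_def)
    have "t \<le> card (common D (A \<union> E) - Q)"
      using good(2) Q(2,3) diff_card_le_card_Diff[of Q "common D (A \<union> E)"] by (simp add: good_def)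
    then obtain F where F: "F \<subseteq> common D (A \<union> E) - Q" "card F = t"
      by (rule obtain_subset_with_card_n)
    have img: "card (g ` X) = card X" if "X \<subseteq> {..<L}" for X
      using card_image[OF inj_on_subset[OF g(1) that]] .
    have disj: "g ` X \<inter> g ` X' = {}" if "X \<subseteq> {..<L}" "X' \<subseteq> {..<L}" "X \<inter> X' = {}" for X X'
      using inj_on_image_Int[OF g(1) that(1,2)] that(3) by simp
    show "\<exists>A Q E D F. A \<union> E \<union> D \<subseteq> V \<and> A \<inter> E = {} \<and> A \<inter> D = {} \<and> E \<inter> D = {} \<and> Q \<inter> F = {} \<and>
       card A = t \<and> card Q = t \<and> card E = t \<and> card D = t \<and> card F = t \<and>
       (\<forall>u\<in>D \<union> A. \<forall>v\<in>E. Q \<subseteq> N u v) \<and> (\<forall>u\<in>D. \<forall>v\<in>A \<union> E. F \<subseteq> N u v)"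
    proof (rule exI[of _ "g ` A"], rule exI[of _ Q], rule exI[of _ "g ` E"], rule exI[of _ "g ` D"],
        rule exI[of _ F], intro conjI)
      show "g ` A \<union> g ` E \<union> g ` D \<subseteq> V" using sub g(2) by blast
      show "g ` A \<inter> g ` E = {}" "g ` A \<inter> g ` D = {}" "g ` E \<inter> g ` D = {}"
        using disj sub DAE(2-4) by (auto simp: Int_commute)
      show "Q \<inter> F = {}" using F(1) by auto
      show "\<forall>u\<in>g ` D \<union> g ` A. \<forall>v\<in>g ` E. Q \<subseteq> N u v"
        using Q(1) by (auto simp: common_def B_def)
      show "\<forall>u\<in>g ` D. \<forall>v\<in>g ` A \<union> g ` E. F \<subseteq> N u v"
        using F(1) by (auto simp: common_def B_def)
    qed (use img sub DAE(5-7) Q(2) F(2) in simp_all)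
  qed
qed

section \<open>Folding longer cycles onto five vertices\<close>

text \<open>A homomorphism from the cycle minus an edge on \<open>l\<close> vertices to the one on five vertices,
  whose edges are \<open>012, 123, 234, 340\<close>. Along the vertices \<open>1, 2, \<dots>, l - 1, 0\<close> it reads
  \<open>(012)\<dots>(012)\<close>, \<open>(021)\<dots>(021)3243\<close> or \<open>(012)\<dots>(012)34\<close>, depending on \<open>l mod 3\<close>.\<close>

definition hom_to_C5 :: "nat \<Rightarrow> nat \<Rightarrow> nat" where
  "hom_to_C5 l i =
    (if l mod 3 = 0 then [2, 0, 1] ! (i mod 3)
     else if l mod 3 = 1 then
       (if i = 0 then 3 else if i = l - 1 then 4 else if i = l - 2 then 2 else if i = l - 3 then 3
        else [1, 0, 2] ! (i mod 3))
     else if i = 0 then 4 else if i = l - 1 then 3 else [2, 0, 1] ! (i mod 3))"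

lemma hom_to_C5_less: "hom_to_C5 l i < 5"
proof -
  have "i mod 3 = 0 \<or> i mod 3 = 1 \<or> i mod 3 = 2" by linarith
  then show ?thesis by (auto simp: hom_to_C5_def)
qed

text \<open>The window at 0 is the removed edge, hence \<open>0 < i\<close>. Windows in the periodic
  stretch take the values 0, 1, 2. For \<open>l mod 3 = 0\<close> the period continues across the
  wrap-around; otherwise the final windows are checked one by one and read 213, 132, 324, 243, 430
  for \<open>l mod 3 = 1\<close>, and 123, 234, 340 for \<open>l mod 3 = 2\<close>.\<close>

lemma hom_to_C5_edge:
  assumes "l \<ge> 5" "0 < i" "i < l"
  shows "{hom_to_C5 l i, hom_to_C5 l ((i + 1) mod l), hom_to_C5 l ((i + 2) mod l)}
    \<in> {{0, 1, 2}, {1, 2, 3}, {2, 3, 4}, {3, 4, 0}}"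
proof -
  have next1: "(i + 1) mod l = (if i + 1 = l then 0 else i + 1)"
    using assms(3) by auto
  have next2: "(i + 2) mod l = (if i + 1 = l then 1 else if i + 2 = l then 0 else i + 2)"
  proof (cases "i + 1 = l")
    case True
    then have "i + 2 = 1 + l" by linarith
    then show ?thesis using assms(1) True by (simp only: mod_add_self2) simp
  qed (use assms(3) in auto)
  have i3: "i mod 3 = 0 \<and> (i + 1) mod 3 = 1 \<and> (i + 2) mod 3 = 2 \<or>
    i mod 3 = 1 \<and> (i + 1) mod 3 = 2 \<and> (i + 2) mod 3 = 0 \<or>
    i mod 3 = 2 \<and> (i + 1) mod 3 = 0 \<and> (i + 2) mod 3 = 1"
    by presburger
  \<comment> \<open>Three consecutive numbers have all three residues mod 3, and both lists permute
    0, 1, 2.\<close>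
  have window: "{L ! (i mod 3), L ! ((i + 1) mod 3), L ! ((i + 2) mod 3)} = {0, 1, 2}"
    if "L = [2, 0, 1] \<or> L = [1, 0, 2]" for L :: "nat list"
  proof -
    define p q r where "p = i mod 3" and "q = (i + 1) mod 3" and "r = (i + 2) mod 3"
    from i3 have "p = 0 \<and> q = 1 \<and> r = 2 \<or> p = 1 \<and> q = 2 \<and> r = 0 \<or> p = 2 \<and> q = 0 \<and> r = 1"
      unfolding p_def q_def r_def .
    then show ?thesis using that unfolding p_def[symmetric] q_def[symmetric] r_def[symmetric]
      by (elim disjE conjE; hypsubst) auto
  qed
  consider "l mod 3 = 0" | "l mod 3 = 1" | "l mod 3 = 2" by linarith
  then show ?thesis
  proof cases
    case l3: 1
    have hom: "hom_to_C5 l x = [2, 0, 1] ! (x mod 3)" for x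
      using l3 by (simp add: hom_to_C5_def)
    have "i + 1 = l \<or> i + 2 = l \<or> i + 2 < l"
      using assms(3) by linarith
    then show ?thesis
    proof (elim disjE, goal_cases)
      case 1
      then have "i mod 3 = 2" using l3 by presburger+
      with 1 have "hom_to_C5 l i = 1" "hom_to_C5 l ((i + 1) mod l) = 2"
        "hom_to_C5 l ((i + 2) mod l) = 0"
        unfolding next1 next2 using assms(1,2) by (simp_all add: hom)
      then show ?thesis by (simp add: insert_commute)
    next
      case 2
      then have "i mod 3 = 1" "(i + 1) mod 3 = 2" using l3 by presburger+
      with 2 have "hom_to_C5 l i = 0" "hom_to_C5 l ((i + 1) mod l) = 1"
        "hom_to_C5 l ((i + 2) mod l) = 2"
        unfolding next1 next2 using assms(1,2) by (simp_all add: hom)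
      then show ?thesis by (simp add: insert_commute)
    next
      case 3
      then have "hom_to_C5 l i = [2, 0, 1] ! (i mod 3)"
        "hom_to_C5 l ((i + 1) mod l) = [2, 0, 1] ! ((i + 1) mod 3)"
        "hom_to_C5 l ((i + 2) mod l) = [2, 0, 1] ! ((i + 2) mod 3)"
        using assms(2) by (simp_all add: next1 next2 hom)
      then show ?thesis using window[of "[2, 0, 1]"] by simp
    qed
  next
    case l3: 2
    have hom: "hom_to_C5 l 0 = 3" "x + 1 = l \<Longrightarrow> hom_to_C5 l x = 4"
      "x + 2 = l \<Longrightarrow> hom_to_C5 l x = 2" "x + 3 = l \<Longrightarrow> hom_to_C5 l x = 3"
      "0 < x \<Longrightarrow> x + 3 < l \<Longrightarrow> hom_to_C5 l x = [1, 0, 2] ! (x mod 3)" for x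
      using l3 assms(1) by (auto simp: hom_to_C5_def)
    have "7 \<le> l" using assms(1) l3 by presburger
    \<comment> \<open>The special values sit at \<open>l - 3\<close>, \<open>l - 2\<close>,
      \<open>l - 1\<close> and \<open>0\<close>; a window starting at \<open>i > 0\<close> avoids
      them exactly when \<open>i + 5 < l\<close>.\<close>
    have "i + 1 = l \<or> i + 2 = l \<or> i + 3 = l \<or> i + 4 = l \<or> i + 5 = l \<or> i + 5 < l"
      using assms(3) by linarith
    then show ?thesis
    proof (elim disjE, goal_cases)
      case 1
      then have "hom_to_C5 l i = 4" "hom_to_C5 l ((i + 1) mod l) = 3"
        "hom_to_C5 l ((i + 2) mod l) = 0"
        unfolding next1 next2 using assms(1,2) \<open>7 \<le> l\<close> by (simp_all add: hom)
      then show ?thesis by (simp add: insert_commute)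
    next
      case 2
      then have "hom_to_C5 l i = 2" "hom_to_C5 l ((i + 1) mod l) = 4"
        "hom_to_C5 l ((i + 2) mod l) = 3"
        unfolding next1 next2 using assms(1,2) by (simp_all add: hom)
      then show ?thesis by (simp add: insert_commute)
    next
      case 3
      then have "hom_to_C5 l i = 3" "hom_to_C5 l ((i + 1) mod l) = 2"
        "hom_to_C5 l ((i + 2) mod l) = 4"
        unfolding next1 next2 using assms(1,2) by (simp_all add: hom)
      then show ?thesis by (simp add: insert_commute)
    next
      case 4
      then have "i mod 3 = 0" using l3 by presburger+
      with 4 have "hom_to_C5 l i = 1" "hom_to_C5 l ((i + 1) mod l) = 3"
        "hom_to_C5 l ((i + 2) mod l) = 2"
        unfolding next1 next2 using assms(1,2) by (simp_all add: hom)
      then show ?thesis by (simp add: insert_commute)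
    next
      case 5
      then have "i mod 3 = 2" "(i + 1) mod 3 = 0" using l3 by presburger+
      with 5 have "hom_to_C5 l i = 2" "hom_to_C5 l ((i + 1) mod l) = 1"
        "hom_to_C5 l ((i + 2) mod l) = 3"
        unfolding next1 next2 using assms(1,2) by (simp_all add: hom)
      then show ?thesis by (simp add: insert_commute)
    next
      case 6
      then have "hom_to_C5 l i = [1, 0, 2] ! (i mod 3)"
        "hom_to_C5 l ((i + 1) mod l) = [1, 0, 2] ! ((i + 1) mod 3)"
        "hom_to_C5 l ((i + 2) mod l) = [1, 0, 2] ! ((i + 2) mod 3)"
        using assms(2) by (simp_all add: next1 next2 hom)
      then show ?thesis using window[of "[1, 0, 2]"] by simp
    qed
  next
    case l3: 3
    have hom: "hom_to_C5 l 0 = 4" "x + 1 = l \<Longrightarrow> hom_to_C5 l x = 3"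
      "0 < x \<Longrightarrow> x + 1 < l \<Longrightarrow> hom_to_C5 l x = [2, 0, 1] ! (x mod 3)" for x
      using l3 assms(1) by (auto simp: hom_to_C5_def)
    have "i + 1 = l \<or> i + 2 = l \<or> i + 3 = l \<or> i + 3 < l"
      using assms(3) by linarith
    then show ?thesis
    proof (elim disjE, goal_cases)
      case 1
      then have "hom_to_C5 l i = 3" "hom_to_C5 l ((i + 1) mod l) = 4"
        "hom_to_C5 l ((i + 2) mod l) = 0"
        unfolding next1 next2 using assms(1,2) by (simp_all add: hom)
      then show ?thesis by (simp add: insert_commute)
    next
      case 2
      then have "i mod 3 = 0" using l3 by presburger+
      with 2 have "hom_to_C5 l i = 2" "hom_to_C5 l ((i + 1) mod l) = 3"
        "hom_to_C5 l ((i + 2) mod l) = 4"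
        unfolding next1 next2 using assms(1,2) by (simp_all add: hom)
      then show ?thesis by (simp add: insert_commute)
    next
      case 3
      then have "i mod 3 = 2" "(i + 1) mod 3 = 0" using l3 by presburger+
      with 3 have "hom_to_C5 l i = 1" "hom_to_C5 l ((i + 1) mod l) = 2"
        "hom_to_C5 l ((i + 2) mod l) = 3"
        unfolding next1 next2 using assms(1,2) by (simp_all add: hom)
      then show ?thesis by (simp add: insert_commute)
    next
      case 4
      then have "hom_to_C5 l i = [2, 0, 1] ! (i mod 3)"
        "hom_to_C5 l ((i + 1) mod l) = [2, 0, 1] ! ((i + 1) mod 3)"
        "hom_to_C5 l ((i + 2) mod l) = [2, 0, 1] ! ((i + 2) mod 3)"
        using assms(2) by (simp_all add: next1 next2 hom)
      then show ?thesis using window[of "[2, 0, 1]"] by simp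
    qed
  qed
qed

section \<open>Embedding the cycle into a blow-up\<close>

lemma triple_eq_cases:
  assumes "{a, b, c} = {p, q, r}" "p \<noteq> q" "p \<noteq> r" "q \<noteq> r"
  shows "(a = p \<and> b = q \<and> c = r) \<or> (a = p \<and> b = r \<and> c = q) \<or> (a = q \<and> b = p \<and> c = r) \<or>
    (a = q \<and> b = r \<and> c = p) \<or> (a = r \<and> b = p \<and> c = q) \<or> (a = r \<and> b = q \<and> c = p)"
proof -
  have "a \<in> {p, q, r}" "b \<in> {p, q, r}" "c \<in> {p, q, r}"
    "p \<in> {a, b, c}" "q \<in> {a, b, c}" "r \<in> {a, b, c}"
    using assms(1) by blast+
  then show ?thesis using assms(2-4) by auto
qed

text \<open>Edges are unordered, whereas the blow-up hypotheses list their parts in a fixed order;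
  the folding may meet the three parts in any of the six orders.\<close>

lemma triple_in_of_permuted_parts:
  assumes eq: "{a, b, c} = {p, q, r}" "p \<noteq> q" "p \<noteq> r" "q \<noteq> r"
    and xyz: "x \<in> S a" "y \<in> S b" "z \<in> S c"
    and parts: "\<forall>x\<in>S p. \<forall>y\<in>S q. \<forall>z\<in>S r. {x, y, z} \<in> E"
  shows "{x, y, z} \<in> E"
proof -
  have perms: "{x, y, z} = {x, z, y}" "{x, y, z} = {y, x, z}" "{x, y, z} = {y, z, x}"
    "{x, y, z} = {z, x, y}" "{x, y, z} = {z, y, x}"
    by blast+
  from triple_eq_cases[OF eq] show ?thesis
  proof (elim disjE conjE)
    assume "a = p" "b = q" "c = r" then show ?thesis using parts xyz by simp
  next
    assume "a = p" "b = r" "c = q" then show ?thesis using parts xyz unfolding perms(1) by simp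
  next
    assume "a = q" "b = p" "c = r" then show ?thesis using parts xyz unfolding perms(2) by simp
  next
    assume "a = q" "b = r" "c = p" then show ?thesis using parts xyz unfolding perms(4) by simp
  next
    assume "a = r" "b = p" "c = q" then show ?thesis using parts xyz unfolding perms(3) by simp
  next
    assume "a = r" "b = q" "c = p" then show ?thesis using parts xyz unfolding perms(5) by simp
  qed
qed

text \<open>Vertex \<open>i\<close> goes to the \<open>i\<close>-th point of the part
  \<open>S (hom_to_C5 l i)\<close>, under a bijection of \<open>{..<l}\<close> with that part.
  Vertices sharing a part thus get different points, and all others are separated by disjointness of
  the parts. Edges go to edges because the folding is a homomorphism.\<close>

lemma contains_tight_cycle_minus_of_blowup:
  fixes S :: "nat \<Rightarrow> 'a set"
  assumes l: "l \<ge> 5"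
    and S: "\<And>c. c < 5 \<Longrightarrow> S c \<subseteq> verts H" "\<And>c. c < 5 \<Longrightarrow> card (S c) = l"
    and disj: "\<And>c d. c < d \<Longrightarrow> d < 5 \<Longrightarrow> S c \<inter> S d = {}"
    and edges: "\<forall>x\<in>S 0. \<forall>y\<in>S 1. \<forall>z\<in>S 2. {x, y, z} \<in> edges H"
      "\<forall>x\<in>S 1. \<forall>y\<in>S 2. \<forall>z\<in>S 3. {x, y, z} \<in> edges H"
      "\<forall>x\<in>S 2. \<forall>y\<in>S 3. \<forall>z\<in>S 4. {x, y, z} \<in> edges H"
      "\<forall>x\<in>S 3. \<forall>y\<in>S 4. \<forall>z\<in>S 0. {x, y, z} \<in> edges H"
  shows "contains_copy H (tight_cycle_minus l)"
proof -
  have edge: "{x, y, z} \<in> edges H"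
    if T: "{a, b, c} \<in> {{0, 1, 2}, {1, 2, 3}, {2, 3, 4}, {3, 4, 0}}"
      and xyz: "x \<in> S a" "y \<in> S b" "z \<in> S c" for a b c x y z
  proof -
    from T have "{a, b, c} = {0, 1, 2} \<or> {a, b, c} = {1, 2, 3} \<or> {a, b, c} = {2, 3, 4} \<or>
        {a, b, c} = {3, 4, 0}"
      by (simp only: insert_iff empty_iff simp_thms)
    then show ?thesis
    proof (elim disjE)
      assume "{a, b, c} = {0, 1, 2}"
      from triple_in_of_permuted_parts[where S = S, OF this _ _ _ xyz edges(1)] show ?thesis by simp
    next
      assume "{a, b, c} = {1, 2, 3}"
      from triple_in_of_permuted_parts[where S = S, OF this _ _ _ xyz edges(2)] show ?thesis by simp
    next
      assume "{a, b, c} = {2, 3, 4}"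
      from triple_in_of_permuted_parts[where S = S, OF this _ _ _ xyz edges(3)] show ?thesis by simp
    next
      assume "{a, b, c} = {3, 4, 0}"
      from triple_in_of_permuted_parts[where S = S, OF this _ _ _ xyz edges(4)] show ?thesis by simp
    qed
  qed
  \<comment> \<open>\<open>card\<close> is 0 on infinite sets, so \<open>card (S c) = l\<close> with
    \<open>l\<close> positive makes \<open>S c\<close> finite.\<close>
  have "\<exists>h. bij_betw h {..<l} (S c)" if "c < 5" for c
    using that S(2)[OF that] l card.infinite ex_bij_betw_nat_finite[of "S c"]
    by (cases "finite (S c)") (auto simp: atLeast0LessThan)
  then have "\<forall>c\<in>{..<5}. \<exists>h. bij_betw h {..<l} (S c)" by blast
  from bchoice[OF this] obtain h where h: "\<And>c. c < 5 \<Longrightarrow> bij_betw (h c) {..<l} (S c)" by blast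
  define f where "f i = h (hom_to_C5 l i) i" for i
  have f: "f i \<in> S (hom_to_C5 l i)" if "i < l" for i
    using bij_betwE[OF h[OF hom_to_C5_less]] that by (auto simp: f_def)
  have inj: "inj_on f {0..<l}"
  proof (rule inj_onI)
    fix i j assume ij: "i \<in> {0..<l}" "j \<in> {0..<l}" and eq: "f i = f j"
    have less: "hom_to_C5 l i < 5" "hom_to_C5 l j < 5" by (rule hom_to_C5_less)+
    have mem: "f i \<in> S (hom_to_C5 l i)" "f i \<in> S (hom_to_C5 l j)"
      using f[of i] f[of j] ij eq by auto
    have same: "hom_to_C5 l i = hom_to_C5 l j"
    proof (cases "hom_to_C5 l i" "hom_to_C5 l j" rule: linorder_cases)
      case less
      then show ?thesis using disj[OF less \<open>hom_to_C5 l j < 5\<close>] mem by blast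
    next
      case greater
      then show ?thesis using disj[OF greater \<open>hom_to_C5 l i < 5\<close>] mem by blast
    qed
    have "inj_on (h (hom_to_C5 l j)) {..<l}"
      by (rule bij_betw_imp_inj_on[OF h[OF less(2)]])
    moreover have "h (hom_to_C5 l j) i = h (hom_to_C5 l j) j"
      using eq by (simp only: f_def same)
    ultimately show "i = j" using ij by (auto dest: inj_onD)
  qed
  have sub: "f ` {0..<l} \<subseteq> verts H"
    using f S(1)[OF hom_to_C5_less] by (meson atLeastLessThan_iff image_subsetI subsetD)
  have edges_image: "f ` e \<in> edges H" if e: "e \<in> edges (tight_cycle_minus l)" for e
  proof -
    have "(\<exists>i. e = {i, (i + 1) mod l, (i + 2) mod l} \<and> i < l) \<and> e \<noteq> {0, 1, 2}"
      using e by (simp only: tight_cycle_minus_def tight_cycle_def hypergraph.simps Diff_iff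
          mem_Collect_eq singleton_iff simp_thms)
    then obtain i where i: "e = {i, (i + 1) mod l, (i + 2) mod l}" "i < l" "e \<noteq> {0, 1, 2}"
      by (elim conjE exE)
    \<comment> \<open>The window at 0 is precisely the removed edge.\<close>
    have "i \<noteq> 0"
    proof
      assume "i = 0"
      then have "e = {0, 1, 2}" using i(1) l by (simp add: numeral_2_eq_2)
      then show False using i(3) by contradiction
    qed
    then have "0 < i" by simp
    have mods: "(i + 1) mod l < l" "(i + 2) mod l < l" using l by simp_all
    have "{f i, f ((i + 1) mod l), f ((i + 2) mod l)} \<in> edges H"
      by (rule edge[OF hom_to_C5_edge[OF l \<open>0 < i\<close> i(2)] f[OF i(2)] f[OF mods(1)] f[OF mods(2)]])
    then show ?thesis unfolding i(1) by (simp only: image_insert image_empty)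
  qed
  have "verts (tight_cycle_minus l) = {0..<l}"
    by (simp add: tight_cycle_minus_def tight_cycle_def)
  then show ?thesis
    unfolding contains_copy_def using inj sub edges_image by (intro exI[of _ f]) simp
qed

section \<open>From minimum codegree to a copy of the cycle\<close>

text \<open>An edge through \<open>u\<close> and \<open>v\<close> is determined by its third vertex,
  so the codegree is bounded by the size of a set of vertices; such sets are what the averaging
  intersects.\<close>

lemma min_codegree_le_card:
  assumes H: "hypergraph3 H" and uv: "u \<in> verts H" "v \<in> verts H" "u \<noteq> v"
  shows "min_codegree H \<le> card {w\<in>verts H. {u, v, w} \<in> edges H}"
proof -
  have fin: "finite (verts H)" using H by (simp add: hypergraph3_def)
  have "{codegree H u v | u v. u \<in> verts H \<and> v \<in> verts H \<and> u \<noteq> v}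
      \<subseteq> (\<lambda>(u, v). codegree H u v) ` (verts H \<times> verts H)" by auto
  then have "finite {codegree H u v | u v. u \<in> verts H \<and> v \<in> verts H \<and> u \<noteq> v}"
    using fin finite_subset by blast
  then have "min_codegree H \<le> codegree H u v"
    unfolding min_codegree_def using uv by (intro Min_le) auto
  also have "\<dots> \<le> card ((\<lambda>w. {u, v, w}) ` {w\<in>verts H. {u, v, w} \<in> edges H})"
    unfolding codegree_def
  proof (rule card_mono)
    show "{e \<in> edges H. u \<in> e \<and> v \<in> e} \<subseteq> (\<lambda>w. {u, v, w}) ` {w\<in>verts H. {u, v, w} \<in> edges H}"
    proof
      fix e assume "e \<in> {e \<in> edges H. u \<in> e \<and> v \<in> e}"
      then have e: "e \<in> edges H" "u \<in> e" "v \<in> e" "e \<subseteq> verts H" "card e = 3"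
        using H by (auto simp: hypergraph3_def)
      then have "card (e - {u, v}) = 1" using uv(3) by (subst card_Diff_subset) auto
      then obtain w where "e - {u, v} = {w}" by (auto simp: card_1_singleton_iff)
      then have "e = {u, v, w}" using e by auto
      then show "e \<in> (\<lambda>w. {u, v, w}) ` {w\<in>verts H. {u, v, w} \<in> edges H}" using e by auto
    qed
  qed (use fin in simp)
  also have "\<dots> \<le> card {w\<in>verts H. {u, v, w} \<in> edges H}"
    using fin by (intro card_image_le) simp
  finally show ?thesis .
qed

text \<open>The blow-up lemma is applied with part size \<open>l\<close> to the sets
  \<open>N u v\<close> of third vertices of edges through \<open>u\<close> and \<open>v\<close>; the
  cycle embeds into the five parts that it yields.\<close>

lemma contains_tight_cycle_minus:
  assumes "\<alpha> > 0" "l \<ge> 5"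
  shows "\<exists>n0. \<forall>n\<ge>n0. \<forall>H :: 'a hypergraph. hypergraph3 H \<and> card (verts H) = n \<and>
    real (min_codegree H) \<ge> \<alpha> * real n \<longrightarrow> contains_copy H (tight_cycle_minus l)"
proof -
  have "l > 0" using assms by simp
  from blowup_of_large_codegree[OF assms(1) this] obtain n0
    where n0: "\<forall>(V :: 'a set) N. finite V \<longrightarrow> n0 \<le> card V \<longrightarrow>
    (\<forall>u\<in>V. \<forall>v\<in>V. u \<noteq> v \<longrightarrow> N u v \<subseteq> V \<and> \<alpha> * card V \<le> card (N u v)) \<longrightarrow>
    (\<exists>A Q E D F. A \<union> E \<union> D \<subseteq> V \<and> A \<inter> E = {} \<and> A \<inter> D = {} \<and> E \<inter> D = {} \<and> Q \<inter> F = {} \<and>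
       card A = l \<and> card Q = l \<and> card E = l \<and> card D = l \<and> card F = l \<and>
       (\<forall>u\<in>D \<union> A. \<forall>v\<in>E. Q \<subseteq> N u v) \<and> (\<forall>u\<in>D. \<forall>v\<in>A \<union> E. F \<subseteq> N u v))"
    by (elim exE)
  show ?thesis
  proof (rule exI[of _ n0], intro allI impI, elim conjE)
    fix n and H :: "'a hypergraph"
    assume H: "n \<ge> n0" "hypergraph3 H" "card (verts H) = n" "real (min_codegree H) \<ge> \<alpha> * real n"
    define N where "N u v = {w\<in>verts H. {u, v, w} \<in> edges H}" for u v
    have fin: "finite (verts H)" using H by (simp add: hypergraph3_def)
    have n0_le: "n0 \<le> card (verts H)" using H by simp
    have N: "\<forall>u\<in>verts H. \<forall>v\<in>verts H. u \<noteq> v \<longrightarrow>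
        N u v \<subseteq> verts H \<and> \<alpha> * card (verts H) \<le> card (N u v)"
    proof (intro ballI impI conjI)
      fix u v assume uv: "u \<in> verts H" "v \<in> verts H" "u \<noteq> v"
      show "N u v \<subseteq> verts H" by (auto simp: N_def)
      have "real (min_codegree H) \<le> real (card (N u v))"
        unfolding N_def using min_codegree_le_card[OF H(2) uv] by simp
      then show "\<alpha> * card (verts H) \<le> card (N u v)" using H(3,4) by simp
    qed
    from n0[THEN spec, of "verts H", THEN spec, of N, THEN mp, OF fin, THEN mp, OF n0_le,
        THEN mp, OF N]
    obtain A Q E D F where V: "A \<union> E \<union> D \<subseteq> verts H"
      and disj: "A \<inter> E = {}" "A \<inter> D = {}" "E \<inter> D = {}" "Q \<inter> F = {}"
      and cards: "card A = l" "card Q = l" "card E = l" "card D = l" "card F = l"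
      and Q: "\<forall>u\<in>D \<union> A. \<forall>v\<in>E. Q \<subseteq> N u v" and F: "\<forall>u\<in>D. \<forall>v\<in>A \<union> E. F \<subseteq> N u v"
      by (elim exE conjE)
    have "A \<noteq> {}" "E \<noteq> {}" "D \<noteq> {}" using cards \<open>l > 0\<close> by auto
    then obtain a e d where aed: "a \<in> A" "e \<in> E" "d \<in> D" by auto
    \<comment> \<open>Edges have three elements, so a neighbour of a pair differs from both its
      vertices. A point shared by \<open>Q\<close> or \<open>F\<close> with \<open>A\<close>,
      \<open>E\<close> or \<open>D\<close> would be a neighbour of a pair containing it, as
      \<open>A\<close>, \<open>E\<close> and \<open>D\<close> are nonempty.\<close>
    have distinct: "w \<noteq> u \<and> w \<noteq> v" if "w \<in> N u v" for u v w
    proof -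
      have "card {u, v, w} = 3" using that H(2) by (auto simp: N_def hypergraph3_def)
      then show ?thesis by (auto simp: card_insert_if split: if_splits)
    qed
    have disjQ: "A \<inter> Q = {}" "E \<inter> Q = {}" "D \<inter> Q = {}"
      using Q aed distinct by blast+
    have disjF: "A \<inter> F = {}" "E \<inter> F = {}" "D \<inter> F = {}"
      using F aed distinct by blast+
    have "Q \<subseteq> N a e" "F \<subseteq> N d e" using Q F aed by auto
    then have QF: "Q \<subseteq> verts H" "F \<subseteq> verts H" by (auto simp: N_def)
    \<comment> \<open>In this order the triples 012, 123, 234, 340 become \<open>AQE\<close>,
      \<open>QED\<close>, \<open>EDF\<close>, \<open>DFA\<close>: the first two are edges by the
      choice of \<open>Q\<close>, the last two by that of \<open>F\<close>.\<close>
    define S where "S c = [A, Q, E, D, F] ! c" for c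
    have S: "S 0 = A" "S 1 = Q" "S (Suc 0) = Q" "S 2 = E" "S 3 = D" "S 4 = F" by (simp_all add: S_def)
    have less5: "c = 0 \<or> c = 1 \<or> c = 2 \<or> c = 3 \<or> c = 4" if "c < 5" for c :: nat
      using that by linarith
    show "contains_copy H (tight_cycle_minus l)"
    proof (rule contains_tight_cycle_minus_of_blowup[OF assms(2), of S])
      show "S c \<subseteq> verts H" if "c < 5" for c using less5[OF that] V QF S by auto
      show "card (S c) = l" if "c < 5" for c using less5[OF that] cards S by auto
      show "S c \<inter> S d = {}" if "c < d" "d < 5" for c d
      proof -
        have "c < 5" using that by simp
        then show ?thesis
          using less5[OF \<open>c < 5\<close>] less5[OF that(2)] that(1) disj disjQ disjF
          by (elim disjE) (simp_all add: S Int_commute)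
      qed
      have "{x, y, z} \<in> edges H" if "x \<in> A" "y \<in> Q" "z \<in> E" for x y z
      proof -
        have "y \<in> N x z" using that Q by auto
        then show ?thesis by (simp add: N_def insert_commute)
      qed
      then show "\<forall>x\<in>S 0. \<forall>y\<in>S 1. \<forall>z\<in>S 2. {x, y, z} \<in> edges H" by (simp only: S) blast
      have "{x, y, z} \<in> edges H" if "x \<in> Q" "y \<in> E" "z \<in> D" for x y z
      proof -
        have "x \<in> N z y" using that Q by auto
        then show ?thesis by (simp add: N_def insert_commute)
      qed
      then show "\<forall>x\<in>S 1. \<forall>y\<in>S 2. \<forall>z\<in>S 3. {x, y, z} \<in> edges H" by (simp only: S) blast
      have "{x, y, z} \<in> edges H" if "x \<in> E" "y \<in> D" "z \<in> F" for x y z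
      proof -
        have "z \<in> N y x" using that F by auto
        then show ?thesis by (simp add: N_def insert_commute)
      qed
      then show "\<forall>x\<in>S 2. \<forall>y\<in>S 3. \<forall>z\<in>S 4. {x, y, z} \<in> edges H" by (simp only: S) blast
      have "{x, y, z} \<in> edges H" if "x \<in> D" "y \<in> F" "z \<in> A" for x y z
      proof -
        have "y \<in> N x z" using that F by auto
        then show ?thesis by (simp add: N_def insert_commute)
      qed
      then show "\<forall>x\<in>S 3. \<forall>y\<in>S 4. \<forall>z\<in>S 0. {x, y, z} \<in> edges H" by (simp only: S) blast
    qed
  qed
qed

section \<open>The codegree Turan density\<close>

text \<open>\<open>Max\<close> is only informative on a finite nonempty set. Every admissible
  \<open>d\<close> is below \<open>c\<close>, as minimum codegree at least \<open>c\<close> forces a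
  copy, and 0 is admissible; so the maximum is itself admissible and below \<open>c\<close>.\<close>

lemma ex2_tight_cycle_minus_less:
  assumes "l \<ge> 5"
    and copies: "\<And>H :: nat hypergraph. hypergraph3 H \<and> card (verts H) = n \<and>
      real (min_codegree H) \<ge> c \<Longrightarrow> contains_copy H (tight_cycle_minus l)"
  shows "real (ex2 n (tight_cycle_minus l)) < c"
proof -
  define X where "X = {d. \<exists>H :: nat hypergraph. hypergraph3 H \<and> card (verts H) = n \<and>
    \<not> contains_copy H (tight_cycle_minus l) \<and> min_codegree H \<ge> d}"
  have less: "real d < c" if "d \<in> X" for d
  proof -
    from that obtain H :: "nat hypergraph" where H: "hypergraph3 H" "card (verts H) = n"
        "\<not> contains_copy H (tight_cycle_minus l)" "min_codegree H \<ge> d"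
      by (auto simp: X_def)
    then have "real (min_codegree H) < c" using copies[of H] by force
    then show ?thesis using H(4) by linarith
  qed
  have "X \<subseteq> {..nat \<lceil>c\<rceil>}"
  proof
    fix d assume "d \<in> X"
    then show "d \<in> {..nat \<lceil>c\<rceil>}" using less[of d] by simp linarith
  qed
  then have "finite X" using finite_subset by blast
  \<comment> \<open>The edgeless hypergraph contains no copy because the edge
    \<open>{1, 2, 3}\<close> survives the removal of \<open>{0, 1, 2}\<close>. For
    \<open>n < 2\<close> its minimum codegree is unspecified, but as a natural number it is still at
    least 0.\<close>
  define H0 :: "nat hypergraph" where "H0 = \<lparr>verts = {..<n}, edges = {}\<rparr>"
  have "{1, 2, 3} \<in> edges (tight_cycle_minus l)"
    using assms(1) by (auto simp: tight_cycle_minus_def tight_cycle_def intro!: exI[of _ 1])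
  then have "\<not> contains_copy H0 (tight_cycle_minus l)"
    unfolding contains_copy_def H0_def by auto
  then have "0 \<in> X"
    unfolding X_def by (auto simp: H0_def hypergraph3_def intro!: exI[of _ H0])
  then have "Max X \<in> X" using \<open>finite X\<close> by (intro Max_in) auto
  then show ?thesis using less by (simp add: ex2_def X_def)
qed

theorem theorem1p1:
  fixes l :: nat
  assumes "l \<ge> 5"
  shows "convergent (\<lambda>n. real (ex2 n (tight_cycle_minus l)) / real n)
    \<and> codegree_turan_density (tight_cycle_minus l) = 0
    \<and> (\<forall>\<alpha>::real. \<alpha> > 0 \<longrightarrow> (\<exists>n0::nat. \<forall>n \<ge> n0. \<forall>H :: 'a hypergraph.
          hypergraph3 H \<and> card (verts H) = n \<and> real (min_codegree H) \<ge> \<alpha> * real n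
            \<longrightarrow> contains_copy H (tight_cycle_minus l)))"
proof -
  have lim: "(\<lambda>n. real (ex2 n (tight_cycle_minus l)) / real n) \<longlonglongrightarrow> 0"
  proof (rule LIMSEQ_I)
    fix \<epsilon> :: real assume "\<epsilon> > 0"
    from contains_tight_cycle_minus[OF this assms] obtain n0
      where n0: "\<forall>n\<ge>n0. \<forall>H :: nat hypergraph. hypergraph3 H \<and> card (verts H) = n \<and>
        real (min_codegree H) \<ge> \<epsilon> * real n \<longrightarrow> contains_copy H (tight_cycle_minus l)"
      by (elim exE)
    show "\<exists>n0. \<forall>n\<ge>n0. norm (real (ex2 n (tight_cycle_minus l)) / real n - 0) < \<epsilon>"
    \<comment> \<open>The 1 keeps \<open>n\<close> positive for the division.\<close>
    proof (intro exI[of _ "max n0 1"] allI impI)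
      fix n assume n: "max n0 1 \<le> n"
      have "real (ex2 n (tight_cycle_minus l)) < \<epsilon> * real n"
        by (rule ex2_tight_cycle_minus_less[OF assms]) (use n0 n in auto)
      then show "norm (real (ex2 n (tight_cycle_minus l)) / real n - 0) < \<epsilon>"
        using n by (simp add: field_simps)
    qed
  qed
  moreover have "codegree_turan_density (tight_cycle_minus l) = 0"
    unfolding codegree_turan_density_def using lim by (rule limI)
  \<comment> \<open>The limit concerns \<open>ex2\<close> and hence hypergraphs on natural numbers;
    the last conjunct takes vertices of arbitrary type, so the copy lemma is instantiated
    anew.\<close>
  ultimately show ?thesis
    using contains_tight_cycle_minus[where 'a = 'a, OF _ assms] by (auto intro: convergentI)
qed

end
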